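(* Let $\mathcal{G}=(G_n)_{n\ge1}$ be an $\mathrm{Inc}$-invariant chain of graphs with stability index $\mathrm{ind}(\mathcal{G})=r$, sparsity index $\mathrm{sp}(\mathcal{G})=s$, and number of missing edges $\mathrm{me}(\mathcal{G})=m$. Assume that $V(G_r)=[r]$ and that $(1,i),(j,r)\in E(G_r)$ for some $i,j\in[r]$. Denote by $\mathrm{IN}(G_n)$ and $\alpha(G_n)$ the independence complex and the independence number of $G_n$, and let $(f_{-1}(\mathrm{IN}(G_n)),f_0(\mathrm{IN}(G_n)),\dots)$ and $(h_0(\mathrm{IN}(G_n)),h_1(\mathrm{IN}(G_n)),\dots)$ be the $f$-vector and $h$-vector of $\mathrm{IN}(G_n)$. Then, for every $n\ge2r+m$, the following statements hold: (i) $\alpha(G_{n+1})=\alpha(G_n)$. (ii) For every $i\ge0$, $$f_i(\mathrm{IN}(G_{n+1}))=f_i(\mathrm{IN}(G_n))+\binom{s-1}{i}.$$ In particular, $f_i(\mathrm{IN}(G_n))$ is eventually a linear function of $n$ for every $i\ge0$. (iii) Set $d=\alpha(G_n)$. Then for every $i\ge0$, $$h_i(\mathrm{IN}(G_{n+1}))=h_i(\mathrm{IN}(G_n))+(-1)^{i-1}\binom{d-s}{i-1}.$$ In particular, $h_i(\mathrm{IN}(G_n))$ is eventually a linear function of $n$ for every $i\ge0$. (iv) Let $\mathcal{E}(\mathrm{IN}(G_n))$ denote either the ordinary or the reduced Euler characteristic of $\mathrm{IN}(G_n)$. Then $\mathcal{E}(\mathrm{IN}(G_{n+1}))=\mathcal{E}(\mathrm{IN}(G_n))+1$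 if $s=1$, and $\mathcal{E}(\mathrm{IN}(G_{n+1}))=\mathcal{E}(\mathrm{IN}(G_n))$ if $s\ge2$.
   Context: $\mathbb{N}$ is the set of positive integers and $[n]=\{1,\dots,n\}$. Graphs are simple and finite, with vertex set contained in $\mathbb{N}$ (possibly empty); an edge $\{i,j\}$ with $i<j$ is written $(i,j)$. $G\subseteq H$ means $V(G)\subseteq V(H)$ and $E(G)\subseteq E(H)$. $\mathrm{Inc}$ is the monoid of strictly increasing maps $\pi:\mathbb{N}\to\mathbb{N}$, and $\mathrm{Inc}_{n,m}=\{\pi\in\mathrm{Inc}\mid\pi(n)\le m\}$ for $n\le m$. For $\Gamma\subseteq\mathrm{Inc}$ and a graph $G$, $\Gamma(G)$ is the graph with vertex set $\bigcup_{\pi\in\Gamma}\pi(V(G))$ and edge set $\{(\pi(i),\pi(j))\mid \pi\in\Gamma,(i,j)\in E(G)\}$. An $\mathrm{Inc}$-invariant chain of graphs is a sequence $(G_n)_{n\ge1}$ of graphs with $V(G_n)\subseteq[n]$ and $\mathrm{Inc}_{n,m}(G_n)\subseteq G_m$ for all $m\ge n\ge1$. Every such chain stabilizes: there is $r\in\mathbb{N}$ with $\mathrm{Inc}_{n,m}(G_n)=G_m$ for all $m\ge n\ge r$; the smallest such $r$ is the stability index $\mathrm{ind}(\mathcal{G})$. With $r=\mathrm{ind}(\mathcal{G})$, the sparsity index is $\mathrm{sp}(\mathcal{G})=\min\{j-i\mid(i,j)\in E(G_r)\}$, and the number of missing edges is $\mathrm{me}(\mathcal{G})=\binom{|V(G_r)|}{2}-|E(G_r)|$.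 The independence complex $\mathrm{IN}(G)$ is the simplicial complex on $V(G)$ whose faces are the independent sets of $G$; $\alpha(G)$ is the maximum size of an independent set. For a simplicial complex $\Delta$ of dimension $d-1$, $f_i(\Delta)$ is the number of faces with $i+1$ elements ($f_{-1}=1$, and $f_i=0$ for $i\ge d$), and the $h$-vector is given by $h_j(\Delta)=\sum_{i=0}^j(-1)^{j-i}\binom{d-i}{j-i}f_{i-1}(\Delta)$ for $0\le j\le d$, with $h_j=0$ for $j>d$. The Euler characteristic is $\chi(\Delta)=\sum_{i\ge0}(-1)^if_i(\Delta)$ and the reduced one is $\widetilde\chi(\Delta)=\chi(\Delta)-1$. Binomial coefficients $\binom{a}{b}$ with $a\ge0$ are $0$ when $b<0$ or $b>a$. A linear function of $n$ means $an+b$ (with $a=0$ allowed); "eventually" means for all sufficiently large $n$. *)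

theory Defs
  imports Complex_Main
begin

text \<open>
  The paper's natural numbers start at 1.  They are modelled by the type \<open>nat\<close>, with 0 excluded
  explicitly: vertices and indices of chains are positive, and the value of a chain or of an
  increasing map at 0 is never used.  An edge is stored as the pair of its end points in
  increasing order.
\<close>

record graph =
  verts :: "nat set"
  edges :: "(nat \<times> nat) set"

definition is_graph :: "graph \<Rightarrow> bool" where
  "is_graph G \<longleftrightarrow> finite (verts G) \<and> verts G \<subseteq> {1..} \<and>
     edges G \<subseteq> {(i, j). i \<in> verts G \<and> j \<in> verts G \<and> i < j}"

definition subgraph :: "graph \<Rightarrow> graph \<Rightarrow> bool" where
  "subgraph G H \<longleftrightarrow> verts G \<subseteq> verts H \<and> edges G \<subseteq> edges H"

definition Inc :: "(nat \<Rightarrow> nat) set" where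
  "Inc = {\<pi>. strict_mono_on {1..} \<pi> \<and> \<pi> ` {1..} \<subseteq> {1..}}"

definition Inc_upto :: "nat \<Rightarrow> nat \<Rightarrow> (nat \<Rightarrow> nat) set" where
  "Inc_upto n m = {\<pi> \<in> Inc. \<pi> n \<le> m}"

definition act :: "(nat \<Rightarrow> nat) set \<Rightarrow> graph \<Rightarrow> graph" where
  "act \<Gamma> G = \<lparr>verts = (\<Union>\<pi>\<in>\<Gamma>. \<pi> ` verts G),
               edges = {(\<pi> i, \<pi> j) | \<pi> i j. \<pi> \<in> \<Gamma> \<and> (i, j) \<in> edges G}\<rparr>"

definition Inc_chain :: "(nat \<Rightarrow> graph) \<Rightarrow> bool" where
  "Inc_chain G \<longleftrightarrow>
     (\<forall>n\<ge>1. is_graph (G n) \<and> verts (G n) \<subseteq> {1..n}) \<and>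
     (\<forall>n m. 1 \<le> n \<and> n \<le> m \<longrightarrow> subgraph (act (Inc_upto n m) (G n)) (G m))"

text \<open>Every \<open>Inc\<close>-invariant chain stabilizes, so the \<open>LEAST\<close> below is attained for such chains.\<close>

definition ind :: "(nat \<Rightarrow> graph) \<Rightarrow> nat" where
  "ind G = (LEAST r. 1 \<le> r \<and> (\<forall>n m. r \<le> n \<and> n \<le> m \<longrightarrow> act (Inc_upto n m) (G n) = G m))"

text \<open>Meaningful only if the graph \<open>G (ind G)\<close> has an edge.\<close>

definition sp :: "(nat \<Rightarrow> graph) \<Rightarrow> nat" where
  "sp G = Min {j - i | i j. (i, j) \<in> edges (G (ind G))}"

definition me :: "(nat \<Rightarrow> graph) \<Rightarrow> nat" where
  "me G = (card (verts (G (ind G))) choose 2) - card (edges (G (ind G)))"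

definition independent :: "graph \<Rightarrow> nat set \<Rightarrow> bool" where
  "independent G S \<longleftrightarrow> S \<subseteq> verts G \<and> (\<forall>i\<in>S. \<forall>j\<in>S. (i, j) \<notin> edges G)"

definition indep_number :: "graph \<Rightarrow> nat" where
  "indep_number G = Max {card S | S. independent G S}"

text \<open>A simplicial complex is represented by its set of faces, the empty face included.\<close>

definition IN :: "graph \<Rightarrow> nat set set" where
  "IN G = {S. independent G S}"

definition dimension :: "nat set set \<Rightarrow> int" where
  "dimension \<Delta> = int (Max (card ` \<Delta>)) - 1"

text \<open>The index of the f-vector starts at \<open>-1\<close>, hence is an integer.\<close>

definition f_vec :: "nat set set \<Rightarrow> int \<Rightarrow> nat" where
  "f_vec \<Delta> i = card {F \<in> \<Delta>. int (card F) = i + 1}"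

definition h_vec :: "nat set set \<Rightarrow> nat \<Rightarrow> int" where
  "h_vec \<Delta> j =
     (let d = nat (dimension \<Delta> + 1) in
      if j \<le> d
      then \<Sum>i = 0..j. (-1) ^ (j - i) * int ((d - i) choose (j - i)) * int (f_vec \<Delta> (int i - 1))
      else 0)"

text \<open>The sum over all \<open>i \<ge> 0\<close> is cut off at the dimension, above which there are no faces.\<close>

definition euler_char :: "nat set set \<Rightarrow> int" where
  "euler_char \<Delta> = (\<Sum>i | int i \<le> dimension \<Delta>. (-1) ^ i * int (f_vec \<Delta> (int i)))"

definition reduced_euler_char :: "nat set set \<Rightarrow> int" where
  "reduced_euler_char \<Delta> = euler_char \<Delta> - 1"

text \<open>
  Unlike \<open>choose\<close>, whose arguments are natural numbers, this vanishes for a negative lower entry.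
  In a term \<open>(-1) ^ (i - 1) * binom a (int i - 1)\<close> with \<open>i :: nat\<close>, the truncated exponent at
  \<open>i = 0\<close> is therefore harmless.
\<close>

definition binom :: "int \<Rightarrow> int \<Rightarrow> int" where
  "binom a b = (if b < 0 \<or> b > a then 0 else int (nat a choose nat b))"

definition eventually_linear :: "(nat \<Rightarrow> int) \<Rightarrow> bool" where
  "eventually_linear g \<longleftrightarrow> (\<exists>a b :: int. \<forall>\<^sub>F n in sequentially. g n = a * int n + b)"

end

theory Submission
  imports Defs "HOL-Library.Product_Order"
begin

text \<open>
  From its stability index \<open>r\<close> on, the chain is determined by the edge set \<open>E\<close> of \<open>G r\<close>: a pair
  \<open>(a, b)\<close> is an edge of \<open>G n\<close> iff for some \<open>(i, j) \<in> E\<close> the three gaps \<open>a\<close>, \<open>b - a\<close> and \<open>n - b\<close>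
  are at least \<open>i\<close>, \<open>j - i\<close> and \<open>r - j\<close>.  (That the least \<open>r\<close> in the definition of \<open>ind\<close> exists at
  all is Dickson's lemma for these triples of gaps.)

  Let \<open>s\<close> be the smallest length \<open>j - i\<close> of an edge in \<open>E\<close>.  All edges of \<open>G n\<close> have length at least
  \<open>s\<close>, so every set of diameter less than \<open>s\<close> is independent.  Passing from \<open>n\<close> to \<open>n + 1\<close>, the new
  sets of this kind are those containing \<open>n + 1\<close>; they consist of \<open>n + 1\<close> and a subset of the \<open>s - 1\<close>
  preceding numbers, so \<open>s - 1 choose i\<close> of them have \<open>i + 1\<close> elements.

  The independent sets of diameter at least \<open>s\<close> do not change in number.  Far from both ends of
  \<open>{1..n}\<close> all pairs at distance at least \<open>s\<close> are edges, so a non-edge of length at least \<open>s\<close> has an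
  end point near \<open>1\<close> or near \<open>n\<close>.  The edges of \<open>E\<close> at the vertices \<open>1\<close> and \<open>r\<close> force it to be
  short, hence to stay near that end, or else to connect the two ends.  Quantitatively, if
  \<open>(1, u + 2)\<close> is the shortest edge at \<open>1\<close> and \<open>(r - 1 - v, r)\<close> the shortest edge at \<open>r\<close>, then at least \<open>u + v\<close> edges are missing in \<open>G r\<close>, so \<open>u + v \<le> m\<close>, and for
  \<open>n \<ge> 2 * r + m\<close> there is room for a position, the cut \<open>r + u\<close>, that no independent set of large
  diameter contains (\<open>cut_notin_long_face\<close>).  If such a set has elements on both sides of the cut,
  these are at distance at least \<open>r\<close> (\<open>long_face_gap\<close>), which is more than the length of every edge
  in \<open>E\<close>.  Hence moving everything from the cut on by one position is a bijection from the
  independent sets of large diameter of \<open>G n\<close> to those of \<open>G (n + 1)\<close> (\<open>long_faces_Suc\<close>).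

  Thus every \<open>f\<^sub>i\<close> grows by \<open>s - 1 choose i\<close>.  Only faces of at most \<open>s\<close> elements are added, and faces
  of \<open>s\<close> elements are always present, so the dimension is constant.  The formulas for the \<open>h\<close>-vector
  and the Euler characteristic follow by inserting the increment of the \<open>f\<close>-vector into the defining
  sums, which are linear in the \<open>f\<close>-vector once the dimension is fixed.
\<close>

section \<open>Stabilization of chains\<close>

text \<open>
  Every real sequence has a monotone subsequence; a decreasing sequence of natural numbers is
  constant from the place on where its minimum is attained.
\<close>
lemma nat_seq_mono_subseq:
  fixes f :: "nat \<Rightarrow> nat"
  obtains g :: "nat \<Rightarrow> nat" where "strict_mono g" "mono (f \<circ> g)"
proof -
  obtain g where g: "strict_mono g" and ms: "monoseq (\<lambda>n. f (g n))"
    using seq_monosub[of f] by auto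
  show thesis
  proof (cases "incseq (\<lambda>n. f (g n))")
    case True
    with g show ?thesis by (intro that[of g]) (simp_all add: comp_def)
  next
    case False
    then have dec: "decseq (\<lambda>n. f (g n))"
      using ms by (simp add: monoseq_iff)
    obtain k where k: "\<And>n. f (g k) \<le> f (g n)"
      using ex_has_least_nat[of "\<lambda>_. True" 0 "\<lambda>n. f (g n)"] by auto
    have eq: "f (g (n + k)) = f (g k)" for n
      using decseqD[OF dec, of k "n + k"] k[of "n + k"] by simp
    have "strict_mono (\<lambda>n. g (n + k))"
      using g by (simp add: strict_mono_def)
    moreover have "mono (f \<circ> (\<lambda>n. g (n + k)))"
      by (simp add: mono_def eq)
    ultimately show ?thesis by (rule that)
  qed
qed

text \<open>
  Dickson's lemma.  The minimal elements of \<open>U\<close> form an antichain, while by taking monotone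
  subsequences in each coordinate in turn any infinite sequence of triples contains two comparable
  members.
\<close>
lemma finite_dominating_subset:
  fixes U :: "(nat \<times> nat \<times> nat) set"
  obtains B where "finite B" "B \<subseteq> U" "\<And>x. x \<in> U \<Longrightarrow> \<exists>y\<in>B. y \<le> x"
proof -
  define M where "M = {x \<in> U. \<forall>y\<in>U. y \<le> x \<longrightarrow> y = x}"
  have "finite M"
  proof (rule ccontr)
    assume "infinite M"
    then obtain f :: "nat \<Rightarrow> nat \<times> nat \<times> nat" where f: "inj f" "range f \<subseteq> M"
      using infinite_countable_subset by blast
    obtain g1 :: "nat \<Rightarrow> nat" where g1: "strict_mono g1" "mono ((\<lambda>n. fst (f n)) \<circ> g1)"
      by (rule nat_seq_mono_subseq[of "\<lambda>n. fst (f n)"])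
    obtain g2 :: "nat \<Rightarrow> nat" where g2: "strict_mono g2" "mono ((\<lambda>n. fst (snd (f (g1 n)))) \<circ> g2)"
      by (rule nat_seq_mono_subseq[of "\<lambda>n. fst (snd (f (g1 n)))"])
    obtain g3 :: "nat \<Rightarrow> nat" where g3: "strict_mono g3" "mono ((\<lambda>n. snd (snd (f (g1 (g2 n))))) \<circ> g3)"
      by (rule nat_seq_mono_subseq[of "\<lambda>n. snd (snd (f (g1 (g2 n))))"])
    define h where "h n = g1 (g2 (g3 n))" for n
    have lt: "h 0 < h 1"
      using g1(1) g2(1) g3(1) by (simp add: h_def strict_mono_less)
    have "g3 0 \<le> g3 1" "g2 (g3 0) \<le> g2 (g3 1)"
      using g2(1) g3(1) by (simp_all add: strict_mono_less_eq)
    then have "f (h 0) \<le> f (h 1)"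
      using monoD[OF g1(2), of "g2 (g3 0)" "g2 (g3 1)"] monoD[OF g2(2), of "g3 0" "g3 1"]
        monoD[OF g3(2), of 0 1]
      by (simp add: h_def less_eq_prod_def)
    moreover have "f (h 0) \<in> M" "f (h 1) \<in> M" using f(2) by auto
    ultimately have "f (h 0) = f (h 1)" by (auto simp: M_def)
    with f(1) lt show False by (auto dest: injD)
  qed
  moreover have "M \<subseteq> U" by (auto simp: M_def)
  moreover have "\<exists>y\<in>M. y \<le> x" if "x \<in> U" for x
    using that
  proof (induction "fst x + fst (snd x) + snd (snd x)" arbitrary: x rule: less_induct)
    case less
    show ?case
    proof (cases "x \<in> M")
      case False
      then obtain y where y: "y \<in> U" "y \<le> x" "y \<noteq> x" using less.prems by (auto simp: M_def)
      then have "fst y + fst (snd y) + snd (snd y) < fst x + fst (snd x) + snd (snd x)"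
        by (cases x; cases y) (auto simp: less_eq_prod_def)
      from less.hyps[OF this y(1)] y(2) show ?thesis by (meson order_trans)
    qed auto
  qed
  ultimately show thesis by (rule that)
qed

text \<open>
  The explicit form of the edge set that the maps \<open>\<pi>\<close> with \<open>\<pi> n \<le> m\<close> produce from an edge set \<open>E\<close>
  on \<open>{1..n}\<close>.  The inequalities compare the gaps \<open>a\<close>, \<open>b - a\<close>, \<open>m - b\<close> with \<open>i\<close>, \<open>j - i\<close>, \<open>n - j\<close>,
  written without subtraction.
\<close>
definition stretch :: "nat \<Rightarrow> (nat \<times> nat) set \<Rightarrow> nat \<Rightarrow> (nat \<times> nat) set" where
  "stretch n E m = {(a, b). \<exists>(i, j)\<in>E. i \<le> a \<and> a + j \<le> b + i \<and> b + n \<le> m + j}"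

lemma Inc_add_le:
  assumes "\<pi> \<in> Inc" "1 \<le> i" "i \<le> j"
  shows "\<pi> i + j \<le> \<pi> j + i"
  using assms(3)
proof (induction j rule: dec_induct)
  case (step k)
  have "\<pi> k < \<pi> (Suc k)"
    using assms(1,2) step(1) by (intro strict_mono_onD[of "{1..}" \<pi>]) (auto simp: Inc_def)
  with step show ?case by simp
qed simp

lemma Inc_le:
  assumes "\<pi> \<in> Inc" "1 \<le> i"
  shows "i \<le> \<pi> i"
proof -
  have "\<pi> 1 \<in> {1..}" using assms(1) unfolding Inc_def by blast
  then show ?thesis using Inc_add_le[of \<pi> 1 i] assms by simp
qed

text \<open>
  The map that moves the vertices from \<open>i\<close> on by \<open>a - i\<close> and those from \<open>j\<close> on by \<open>b - j\<close> in total has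
  the least possible value at every \<open>k \<ge> j\<close>.  The case \<open>i = j\<close> serves single vertices.
\<close>
lemma Inc_interpolation:
  assumes "1 \<le> i" "i \<le> j" "i \<le> a" "a + j \<le> b + i" "i = j \<longrightarrow> a = b"
  obtains \<pi> where "\<pi> \<in> Inc" "\<pi> i = a" "\<pi> j = b" "\<And>k. j \<le> k \<Longrightarrow> \<pi> k + j = b + k"
proof
  let ?\<pi> = "\<lambda>k. if k < i then k else if k < j then a + (k - i) else b + (k - j)"
  show "?\<pi> \<in> Inc"
    unfolding Inc_def strict_mono_on_def using assms by auto
qed (use assms in auto)

lemma edges_act_Inc_upto:
  assumes "is_graph H" "verts H \<subseteq> {1..n}"
  shows "edges (act (Inc_upto n m) H) = stretch n (edges H) m"
proof (intro equalityI subrelI)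
  have E: "1 \<le> i \<and> i < j \<and> j \<le> n" if "(i, j) \<in> edges H" for i j
    using that assms by (auto simp: is_graph_def)
  fix a b
  {
    assume "(a, b) \<in> edges (act (Inc_upto n m) H)"
    then obtain \<pi> i j where *: "\<pi> \<in> Inc" "\<pi> n \<le> m" "(i, j) \<in> edges H" "a = \<pi> i" "b = \<pi> j"
      by (auto simp: act_def Inc_upto_def)
    have "i \<le> a" "a + j \<le> b + i" "b + n \<le> m + j"
      using E[OF *(3)] * Inc_le[OF *(1), of i] Inc_add_le[OF *(1), of i j]
        Inc_add_le[OF *(1), of j n] by auto
    with *(3) show "(a, b) \<in> stretch n (edges H) m" by (auto simp: stretch_def)
  next
    assume "(a, b) \<in> stretch n (edges H) m"
    then obtain i j where *: "(i, j) \<in> edges H" "i \<le> a" "a + j \<le> b + i" "b + n \<le> m + j"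
      by (auto simp: stretch_def)
    obtain \<pi> where \<pi>: "\<pi> \<in> Inc" "\<pi> i = a" "\<pi> j = b" "\<And>k. j \<le> k \<Longrightarrow> \<pi> k + j = b + k"
      using E[OF *(1)] * by (auto intro: Inc_interpolation[of i j a b])
    have "\<pi> n + j = b + n" using \<pi>(4) E[OF *(1)] by simp
    then have "\<pi> \<in> Inc_upto n m" using \<pi>(1) *(4) by (simp add: Inc_upto_def)
    with \<pi> *(1) show "(a, b) \<in> edges (act (Inc_upto n m) H)" by (force simp: act_def)
  }
qed

lemma verts_act_Inc_upto:
  assumes "is_graph H" "verts H \<subseteq> {1..n}"
  shows "verts (act (Inc_upto n m) H) = {a. \<exists>i\<in>verts H. i \<le> a \<and> a + n \<le> m + i}"
proof (intro equalityI subsetI)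
  have V: "1 \<le> i \<and> i \<le> n" if "i \<in> verts H" for i
    using that assms by auto
  fix a
  {
    assume "a \<in> verts (act (Inc_upto n m) H)"
    then obtain \<pi> i where *: "\<pi> \<in> Inc" "\<pi> n \<le> m" "i \<in> verts H" "a = \<pi> i"
      by (auto simp: act_def Inc_upto_def)
    have "i \<le> a" "a + n \<le> m + i"
      using V[OF *(3)] * Inc_le[OF *(1), of i] Inc_add_le[OF *(1), of i n] by auto
    with *(3) show "a \<in> {a. \<exists>i\<in>verts H. i \<le> a \<and> a + n \<le> m + i}" by auto
  next
    assume "a \<in> {a. \<exists>i\<in>verts H. i \<le> a \<and> a + n \<le> m + i}"
    then obtain i where *: "i \<in> verts H" "i \<le> a" "a + n \<le> m + i" by auto
    obtain \<pi> where \<pi>: "\<pi> \<in> Inc" "\<pi> i = a" "\<And>k. i \<le> k \<Longrightarrow> \<pi> k + i = a + k"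
      using V[OF *(1)] * by (auto intro: Inc_interpolation[of i i a a])
    have "\<pi> n + i = a + n" using \<pi>(3) V[OF *(1)] by simp
    then have "\<pi> \<in> Inc_upto n m" using \<pi>(1) *(3) by (simp add: Inc_upto_def)
    with \<pi> *(1) show "a \<in> verts (act (Inc_upto n m) H)" by (force simp: act_def)
  }
qed

text \<open>
  An edge of \<open>G m\<close> that comes from some \<open>G k\<close> with \<open>k \<le> n \<le> m\<close> also comes from \<open>G n\<close>: an edge of
  \<open>G n\<close> corresponds to a triple of gaps of sum \<open>n\<close>, and the triples between two given ones attain
  every sum in between.
\<close>
lemma triple_between:
  fixes x y z X Y Z n :: nat
  assumes "x \<le> X" "y \<le> Y" "z \<le> Z" "x + y + z \<le> n" "n \<le> X + Y + Z"
  obtains x' y' z' where "x \<le> x'" "x' \<le> X" "y \<le> y'" "y' \<le> Y" "z \<le> z'" "z' \<le> Z" "x' + y' + z' = n"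
proof -
  define x' where "x' = min X (n - y - z)"
  define y' where "y' = min Y (n - x' - z)"
  have x': "x \<le> x'" "x' \<le> X" "x' + y + z \<le> n" "n \<le> x' + Y + Z"
    using assms unfolding x'_def min_def by auto
  have y': "y \<le> y'" "y' \<le> Y" "x' + y' + z \<le> n" "n \<le> x' + y' + Z"
    using x' assms(2,3) unfolding y'_def min_def by auto
  show thesis
    by (rule that[of x' y' "n - x' - y'"]) (use x' y' in auto)
qed

text \<open>
  Edges of all graphs of the chain are recorded by their triples of gaps.  Finitely many of these
  triples dominate all others, so all edges come from the graphs \<open>G k\<close> with bounded \<open>k\<close>.  The vertices are treated
  in the same way, with middle entry \<open>0\<close>.
\<close>
lemma Inc_chain_stabilizes:
  assumes "Inc_chain G"
  shows "\<exists>r\<ge>1. \<forall>n m. r \<le> n \<and> n \<le> m \<longrightarrow> act (Inc_upto n m) (G n) = G m"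
proof -
  have gr: "is_graph (G n)" "verts (G n) \<subseteq> {1..n}" if "1 \<le> n" for n
    using assms that by (auto simp: Inc_chain_def)
  have sub: "subgraph (act (Inc_upto n m) (G n)) (G m)" if "1 \<le> n" "n \<le> m" for n m
    using assms that by (auto simp: Inc_chain_def)
  have E: "1 \<le> i \<and> i < j \<and> j \<le> n" if "(i, j) \<in> edges (G n)" "1 \<le> n" for i j n
    using that gr[of n] by (auto simp: is_graph_def)
  define U where "U = {(i, j - i, n - j) | i j n. 1 \<le> n \<and> (i, j) \<in> edges (G n)}"
  define W where "W = {(i, 0::nat, n - i) | i n. 1 \<le> n \<and> i \<in> verts (G n)}"
  obtain B where B: "finite B" "B \<subseteq> U" "\<And>x. x \<in> U \<Longrightarrow> \<exists>y\<in>B. y \<le> x"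
    by (rule finite_dominating_subset) blast
  obtain C where C: "finite C" "C \<subseteq> W" "\<And>x. x \<in> W \<Longrightarrow> \<exists>y\<in>C. y \<le> x"
    by (rule finite_dominating_subset) blast
  define level :: "nat \<times> nat \<times> nat \<Rightarrow> nat" where "level = (\<lambda>(x, y, z). x + y + z)"
  obtain r where r: "1 \<le> r" "\<And>x. x \<in> B \<union> C \<Longrightarrow> level x \<le> r"
  proof
    let ?r = "Max (insert 1 (level ` (B \<union> C)))"
    show "1 \<le> ?r" "\<And>x. x \<in> B \<union> C \<Longrightarrow> level x \<le> ?r" using B(1) C(1) by auto
  qed
  have "act (Inc_upto n m) (G n) = G m" if n: "r \<le> n" "n \<le> m" for n m
  proof -
    have n1: "1 \<le> n" "1 \<le> m" using n r(1) by auto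
    have "edges (G m) \<subseteq> edges (act (Inc_upto n m) (G n))"
    proof (rule subrelI)
      fix a b assume ab: "(a, b) \<in> edges (G m)"
      then have "(a, b - a, m - b) \<in> U" using n1 by (auto simp: U_def)
      from B(3)[OF this] obtain i d e where y: "(i, d, e) \<in> B" "i \<le> a" "d \<le> b - a" "e \<le> m - b"
        by (auto simp: less_eq_prod_def)
      have lev: "i + d + e \<le> n" using r(2)[of "(i, d, e)"] y(1) n(1) by (simp add: level_def)
      obtain j k where jk: "1 \<le> k" "(i, j) \<in> edges (G k)" "d = j - i" "e = k - j"
        using y(1) B(2) by (auto simp: U_def)
      have ijk: "j = i + d" "k = i + d + e" using E[OF jk(2,1)] jk(3,4) by auto
      obtain i' d' e' where *: "i \<le> i'" "i' \<le> a" "d \<le> d'" "d' \<le> b - a" "e \<le> e'" "e' \<le> m - b"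
          "i' + d' + e' = n"
        using triple_between[of i a d "b - a" e "m - b" n] y lev n(2) E[OF ab n1(2)] by auto
      have "(i', i' + d') \<in> stretch k (edges (G k)) n"
        using jk(2) * ijk by (auto simp: stretch_def intro!: bexI[of _ "(i, j)"])
      then have "(i', i' + d') \<in> edges (G n)"
        using sub[of k n] jk(1) ijk lev edges_act_Inc_upto[OF gr, of k n] by (auto simp: subgraph_def)
      then have "(a, b) \<in> stretch n (edges (G n)) m"
        using * E[OF ab n1(2)] by (auto simp: stretch_def intro!: bexI[of _ "(i', i' + d')"])
      then show "(a, b) \<in> edges (act (Inc_upto n m) (G n))"
        using edges_act_Inc_upto[OF gr, of n m] n1 by simp
    qed
    moreover have "verts (G m) \<subseteq> verts (act (Inc_upto n m) (G n))"
    proof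
      fix a assume a: "a \<in> verts (G m)"
      then have "(a, 0, m - a) \<in> W" using n1 by (auto simp: W_def)
      from C(3)[OF this] obtain i d e where y: "(i, d, e) \<in> C" "i \<le> a" "d \<le> 0" "e \<le> m - a"
        by (auto simp: less_eq_prod_def)
      have lev: "i + e \<le> n" using r(2)[of "(i, d, e)"] y n(1) by (simp add: level_def)
      obtain k where k: "1 \<le> k" "i \<in> verts (G k)" "e = k - i"
        using y(1) C(2) by (auto simp: W_def)
      have ik: "1 \<le> i" "k = i + e" using gr(2)[OF k(1)] k by auto
      have am: "a \<le> m" using gr(2)[OF n1(2)] a by auto
      obtain i' d' e' where *: "i \<le> i'" "i' \<le> a" "d' \<le> 0" "e \<le> e'" "e' \<le> m - a"
          "i' + d' + e' = n"
        using triple_between[of i a 0 0 e "m - a" n] y lev n(2) am by auto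
      have "i \<le> i'" "i' + k \<le> n + i" using * ik(2) by linarith+
      then have "i' \<in> verts (act (Inc_upto k n) (G k))"
        using k(2) unfolding verts_act_Inc_upto[OF gr[OF k(1)]] by blast
      then have "i' \<in> verts (G n)"
        using sub[of k n] k(1) ik lev by (auto simp: subgraph_def)
      moreover have "i' \<le> a" "a + n \<le> m + i'" using * am by linarith+
      ultimately show "a \<in> verts (act (Inc_upto n m) (G n))"
        unfolding verts_act_Inc_upto[OF gr[OF n1(1)]] by blast
    qed
    ultimately show ?thesis
      using sub[OF n1(1) n(2)] by (intro graph.equality) (auto simp: subgraph_def)
  qed
  with r(1) show ?thesis by auto
qed

lemma stable_at_ind:
  assumes "Inc_chain G"
  shows "1 \<le> ind G" "ind G \<le> n \<Longrightarrow> n \<le> m \<Longrightarrow> act (Inc_upto n m) (G n) = G m"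
proof -
  have *: "1 \<le> ind G \<and> (\<forall>n m. ind G \<le> n \<and> n \<le> m \<longrightarrow> act (Inc_upto n m) (G n) = G m)"
    unfolding ind_def by (rule LeastI_ex) (use Inc_chain_stabilizes[OF assms] in auto)
  then show "1 \<le> ind G" "ind G \<le> n \<Longrightarrow> n \<le> m \<Longrightarrow> act (Inc_upto n m) (G n) = G m" by auto
qed

definition stretched :: "nat \<Rightarrow> (nat \<times> nat) set \<Rightarrow> nat \<Rightarrow> graph" where
  "stretched r E n = \<lparr>verts = {1..n}, edges = stretch r E n\<rparr>"

lemma chain_eq_stretched:
  assumes "Inc_chain G" "verts (G (ind G)) = {1..ind G}" "ind G \<le> n"
  shows "G n = stretched (ind G) (edges (G (ind G))) n"
proof -
  let ?r = "ind G"
  have r: "1 \<le> ?r" by (rule stable_at_ind[OF assms(1)])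
  have gr: "is_graph (G ?r)" using assms(1) r by (auto simp: Inc_chain_def)
  have act: "act (Inc_upto ?r n) (G ?r) = G n"
    using stable_at_ind(2)[OF assms(1)] assms(3) by simp
  have "a \<in> verts (G n) \<longleftrightarrow> a \<in> {1..n}" for a
  proof
    assume "a \<in> {1..n}"
    then have "\<exists>i\<in>{1..?r}. i \<le> a \<and> a + ?r \<le> n + i"
      using r assms(3) by (intro bexI[of _ "min a ?r"]) auto
    then show "a \<in> verts (G n)"
      using verts_act_Inc_upto[OF gr, of ?r n] act assms(2) by simp
  next
    assume "a \<in> verts (G n)"
    then show "a \<in> {1..n}"
      using assms(1,3) r unfolding Inc_chain_def by (meson le_trans subsetD)
  qed
  moreover have "edges (G n) = stretch ?r (edges (G ?r)) n"
    using edges_act_Inc_upto[OF gr, of ?r n] act assms(2) by simp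
  ultimately show ?thesis by (intro graph.equality) (auto simp: stretched_def)
qed

section \<open>Missing edges\<close>

text \<open>
  The situation at the stability index: \<open>E\<close> is the edge set of a graph on \<open>{1..r}\<close> whose first and
  last vertex are not isolated, \<open>s\<close> the length of a shortest edge, and \<open>m\<close> the number of pairs that
  are not edges.
\<close>
locale seed_graph =
  fixes r s m :: nat and E :: "(nat \<times> nat) set"
  assumes E_bounds: "(i, j) \<in> E \<Longrightarrow> 1 \<le> i \<and> i < j \<and> j \<le> r"
    and first_vertex: "\<exists>i. (1, i) \<in> E"
    and last_vertex: "\<exists>j. (j, r) \<in> E"
    and shortest: "\<exists>i. (i, i + s) \<in> E"
    and length_ge: "(i, j) \<in> E \<Longrightarrow> i + s \<le> j"
    and m_def: "m = (r choose 2) - card E"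
begin

text \<open>All lower bounds on \<open>m\<close> below are obtained from this, by exhibiting families of missing pairs.\<close>
lemma missing_le:
  assumes "M \<subseteq> {(i, j). 1 \<le> i \<and> i < j \<and> j \<le> r}" "M \<inter> E = {}"
  shows "card M \<le> m"
proof -
  let ?P = "{(i, j). 1 \<le> i \<and> i < j \<and> j \<le> r}"
  have fin: "finite ?P" by (rule finite_subset[of _ "{1..r} \<times> {1..r}"]) auto
  have EP: "E \<subseteq> ?P" using E_bounds by auto
  have "card ?P \<le> card {B. B \<subseteq> {1..r} \<and> card B = 2}"
  proof (rule card_inj_on_le[of "\<lambda>(i, j). {i, j}"])
    show "inj_on (\<lambda>(i, j). {i, j}) ?P" by (auto simp: inj_on_def doubleton_eq_iff)
  qed auto
  also have "\<dots> = r choose 2" using n_subsets[of "{1..r}" 2] by simp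
  finally have "card ?P \<le> r choose 2" .
  moreover have "card M + card E = card (M \<union> E)"
    using assms fin EP by (intro card_Un_disjoint[symmetric]) (auto intro: finite_subset)
  moreover have "card (M \<union> E) \<le> card ?P" using assms(1) EP fin by (intro card_mono) auto
  ultimately show ?thesis by (simp add: m_def)
qed

text \<open>
  The numbers of missing edges at the first and at the last vertex that are shorter than the
  shortest edge there.
\<close>
definition u :: nat where "u = (LEAST i. (1, i) \<in> E) - 2"
definition v :: nat where "v = r - 1 - (GREATEST j. (j, r) \<in> E)"

lemma first_edge: "(1, u + 2) \<in> E"
  and first_missing: "k < u + 2 \<Longrightarrow> (1, k) \<notin> E"
proof -
  have "(1, LEAST i. (1, i) \<in> E) \<in> E" using first_vertex by (rule LeastI_ex)
  moreover from E_bounds[OF this] have eq: "(LEAST i. (1, i) \<in> E) = u + 2"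
    unfolding u_def by linarith
  ultimately show "(1, u + 2) \<in> E" by simp
  show "k < u + 2 \<Longrightarrow> (1, k) \<notin> E" using not_less_Least[of k "\<lambda>i. (1, i) \<in> E"] unfolding eq by blast
qed

lemma last_edge: "(r - 1 - v, r) \<in> E"
  and v_less: "v + 1 < r"
  and last_missing: "r - 1 - v < k \<Longrightarrow> (k, r) \<notin> E"
proof -
  let ?j = "GREATEST j. (j, r) \<in> E"
  have bound: "k \<le> r" if "(k, r) \<in> E" for k
    using E_bounds[OF that] by simp
  have j: "(?j, r) \<in> E"
    by (rule GreatestI_ex_nat[where b = r]) (use last_vertex bound in auto)
  from E_bounds[OF this] have eq: "?j = r - 1 - v" "v + 1 < r" unfolding v_def by linarith+
  with j show "(r - 1 - v, r) \<in> E" "v + 1 < r" by simp_all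
  have "k \<le> ?j" if "(k, r) \<in> E" for k
    using that bound by (rule Greatest_le_nat)
  then show "r - 1 - v < k \<Longrightarrow> (k, r) \<notin> E" unfolding eq(1) by fastforce
qed

lemma u_less: "u + 2 \<le> r" and s_le_u: "s \<le> u + 1" and s_pos: "1 \<le> s" and s_less_r: "s < r"
proof -
  show "u + 2 \<le> r" "s \<le> u + 1"
    using E_bounds[OF first_edge] length_ge[OF first_edge] by linarith+
  obtain p where "(p, p + s) \<in> E" using shortest by auto
  from E_bounds[OF this] show "1 \<le> s" "s < r" by linarith+
qed

text \<open>
  The missing edges counted by \<open>u\<close> contain the vertex \<open>1\<close> and those counted by \<open>v\<close> the vertex \<open>r\<close>;
  the pair \<open>(1, r)\<close> is counted by neither, since the shortest edges at \<open>1\<close> and \<open>r\<close> are at most as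
  long.
\<close>
lemma u_plus_v: "u + v \<le> m"
proof -
  let ?M = "Pair 1 ` {2..<u + 2} \<union> (\<lambda>k. (k, r)) ` {r - v..<r}"
  have "card ?M = card (Pair (1::nat) ` {2..<u + 2}) + card ((\<lambda>k. (k, r)) ` {r - v..<r})"
    using u_less by (intro card_Un_disjoint) auto
  also have "\<dots> = u + v"
    using v_less by (subst (1 2) card_image) (auto simp: inj_on_def)
  finally have "card ?M = u + v" .
  moreover have "card ?M \<le> m"
    using u_less v_less first_missing last_missing by (intro missing_le) force+
  ultimately show ?thesis by simp
qed

text \<open>
  The position at which a vertex is inserted when passing from \<open>n\<close> to \<open>n + 1\<close>.  It is far enough from
  the left end that no non-edge of length at most \<open>u\<close> reaches it from a vertex below \<open>r\<close>, and far
  enough from the right end by \<open>n \<ge> 2 * r + m\<close> and \<open>u + v \<le> m\<close>.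
\<close>
definition cut :: nat where "cut = r + u"

lemma nonedgeD:
  assumes "(a, b) \<notin> stretch r E n" "(i, j) \<in> E"
  shows "a < i \<or> b + i < a + j \<or> n + j < b + r"
  using assms by (force simp: stretch_def)

text \<open>
  If \<open>b\<close> were not near \<open>n\<close>, the edge \<open>(1, u + 2)\<close> of \<open>E\<close> would bound the length of \<open>(a, b)\<close> by \<open>u\<close>,
  so that \<open>a \<ge> r\<close>.  Then a shortest edge of \<open>E\<close> leaves only the possibility that \<open>b\<close> is at distance
  less than \<open>r\<close> from \<open>n\<close>, and \<open>(r - 1 - v, r)\<close> bounds the length by \<open>v\<close>, which puts \<open>a\<close> beyond the cut.
  So \<open>b\<close> is near \<open>n\<close>, and if \<open>a\<close> were not near \<open>1\<close>, the same bound \<open>v\<close> would put \<open>a\<close> beyond the cut.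
\<close>
lemma crossing_nonedge:
  assumes n: "2 * r + m \<le> n" and non: "(a, b) \<notin> stretch r E n"
    and ab: "1 \<le> a" "a \<le> cut" "cut \<le> b" "b \<le> n" "a + s \<le> b"
  shows "a + v + 1 < r" "n + u + 2 < b + r" "a + r \<le> b"
proof -
  obtain p where p: "(p, p + s) \<in> E" using shortest by auto
  have pr: "1 \<le> p" "p + s \<le> r" using E_bounds[OF p] by auto
  have 1: "b \<le> a + u \<or> n + u + 2 < b + r"
    using nonedgeD[OF non first_edge] ab by auto
  have 2: "a + v + 1 < r \<or> b \<le> a + v"
    using nonedgeD[OF non last_edge] ab v_less by auto
  have 3: "a < p \<or> n + p + s < b + r"
    using nonedgeD[OF non p] ab by auto
  note arith = n ab u_plus_v u_less v_less s_pos pr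
  show b: "n + u + 2 < b + r"
    using 1 2 3 arith unfolding cut_def by linarith
  show a: "a + v + 1 < r"
    using b 2 arith unfolding cut_def by linarith
  show "a + r \<le> b"
  proof (rule ccontr)
    assume short: "\<not> a + r \<le> b"
    \<comment> \<open>If the length \<open>b - a\<close> were less than \<open>r\<close>, then every edge \<open>(k, r)\<close> with \<open>k \<le> a\<close> and
      \<open>r - k \<le> b - a\<close> would make \<open>(a, b)\<close> an edge.  So all these pairs are missing, and there
      are \<open>b - r + 1 > m\<close> of them.\<close>
    let ?M = "(\<lambda>k. (k, r)) ` {r + a - b..a}"
    have "(k, r) \<notin> E" if "k \<in> {r + a - b..a}" for k
      using nonedgeD[OF non, of k r] that ab(4) by auto
    then have "card ?M \<le> m"
      using short a by (intro missing_le) auto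
    moreover have "card ?M = Suc a - (r + a - b)"
      by (subst card_image) (auto simp: inj_on_def)
    ultimately show False using b arith short by linarith
  qed
qed

section \<open>Faces of large and of small diameter\<close>

definition long_faces :: "nat \<Rightarrow> nat set set" where
  "long_faces n = {F \<in> IN (stretched r E n). \<exists>x\<in>F. \<exists>y\<in>F. x + s \<le> y}"

definition short_sets :: "nat \<Rightarrow> nat set set" where
  "short_sets n = {F. F \<subseteq> {1..n} \<and> (\<forall>x\<in>F. \<forall>y\<in>F. y < x + s)}"

lemma face_iff: "F \<in> IN (stretched r E n) \<longleftrightarrow> F \<subseteq> {1..n} \<and> (\<forall>x\<in>F. \<forall>y\<in>F. (x, y) \<notin> stretch r E n)"
  by (simp add: IN_def independent_def stretched_def)

lemma stretch_length: "(a, b) \<in> stretch r E n \<Longrightarrow> a + s \<le> b"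
  using length_ge by (force simp: stretch_def)

lemma faces_split: "IN (stretched r E n) = long_faces n \<union> short_sets n"
  "long_faces n \<inter> short_sets n = {}"
proof -
  show "IN (stretched r E n) = long_faces n \<union> short_sets n"
    unfolding long_faces_def short_sets_def set_eq_iff Un_iff mem_Collect_eq face_iff
    using stretch_length[of _ _ n] by (meson not_less)
  show "long_faces n \<inter> short_sets n = {}"
    by (auto simp: long_faces_def short_sets_def) (meson not_less)
qed

text \<open>
  Some pair in \<open>F\<close> of length at least \<open>s\<close> crosses the cut, since the pair of length at least \<open>s\<close> that
  exists in \<open>F\<close> can be enlarged by \<open>x\<close> or \<open>y\<close>.  By \<open>crossing_nonedge\<close> its ends are near \<open>1\<close> and \<open>n\<close>.
  As \<open>x\<close> and \<open>y\<close> have distance at least \<open>u + 1 \<ge> s\<close> from the opposite end, the same lemma shows that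
  they are near \<open>1\<close> and \<open>n\<close> themselves, and it can then be applied to the pair \<open>(x, y)\<close>.
\<close>
lemma long_face_gap:
  assumes n: "2 * r + m \<le> n" and F: "F \<in> long_faces n"
    and x: "x \<in> F" "x \<le> cut" and y: "y \<in> F" "cut \<le> y"
  shows "x + r \<le> y"
proof -
  have non: "(p, q) \<notin> stretch r E n" "1 \<le> p" "p \<le> n" if "p \<in> F" "q \<in> F" for p q
    using F that by (auto simp: long_faces_def face_iff)
  note cross = crossing_nonedge[OF n non(1) non(2) _ _ non(3)]
  obtain a0 b0 where "a0 \<in> F" "b0 \<in> F" "a0 + s \<le> b0"
    using F by (auto simp: long_faces_def)
  then obtain a b where ab: "a \<in> F" "b \<in> F" "a \<le> cut" "cut \<le> b" "a + s \<le> b"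
    using x y by (cases "a0 \<le> x"; cases "y \<le> b0") (meson add_le_mono1 le_trans linear)+
  note arith = n u_plus_v u_less v_less s_le_u s_less_r
  have a: "a + v + 1 < r" and b: "n + u + 2 < b + r"
    using cross(1,2)[of a b b] ab by blast+
  have y': "n + u + 2 < y + r"
    using cross(2)[of a y y] ab x y a arith unfolding cut_def by simp
  have x': "x + v + 1 < r"
    using cross(1)[of x b b] ab x y b arith unfolding cut_def by simp
  show ?thesis
    using cross(3)[of x y y] x y x' y' arith by simp
qed

text \<open>The case \<open>x = y = cut\<close> of the previous lemma, where the distance is \<open>0 < r\<close>.\<close>
lemma cut_notin_long_face:
  assumes "2 * r + m \<le> n" "F \<in> long_faces n"
  shows "cut \<notin> F"
  using long_face_gap[OF assms, of cut cut] s_less_r by auto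

definition skip :: "nat \<Rightarrow> nat" where
  "skip x = (if x < cut then x else Suc x)"

lemma inj_skip: "inj skip"
  by (auto simp: inj_def skip_def split: if_splits)

text \<open>Inserting a vertex only enlarges the gaps.\<close>
lemma edge_skip:
  assumes "(x, y) \<in> stretch r E n"
  shows "(skip x, skip y) \<in> stretch r E (Suc n)"
proof -
  obtain i j where ij: "(i, j) \<in> E" "i \<le> x" "x + j \<le> y + i" "y + r \<le> n + j"
    using assms by (auto simp: stretch_def)
  have "i \<le> skip x \<and> skip x + j \<le> skip y + i \<and> skip y + r \<le> Suc n + j"
    using ij E_bounds[OF ij(1)] by (auto simp: skip_def)
  with ij(1) show ?thesis by (auto simp: stretch_def)
qed

text \<open>
  Inserting a vertex can turn a non-edge into an edge only if one of its gaps grows from too small to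
  large enough.  The outer gaps are beyond all constraints from \<open>E\<close> when the cut lies in them, and
  the middle one is when it is at least \<open>r\<close>.
\<close>
lemma skip_edge:
  assumes n: "2 * r + m \<le> n" and e: "(skip x, skip y) \<in> stretch r E (Suc n)"
    and gap: "x < cut \<Longrightarrow> cut \<le> y \<Longrightarrow> x + r \<le> y"
  shows "(x, y) \<in> stretch r E n"
proof -
  obtain i j where ij: "(i, j) \<in> E" "i \<le> skip x" "skip x + j \<le> skip y + i"
      "skip y + r \<le> Suc n + j"
    using e by (auto simp: stretch_def)
  have "i \<le> x \<and> x + j \<le> y + i \<and> y + r \<le> n + j"
    using ij E_bounds[OF ij(1)] gap n u_plus_v unfolding skip_def cut_def
    by (auto split: if_splits)
  with ij(1) show ?thesis by (auto simp: stretch_def)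
qed

text \<open>
  Crossing pairs in a large face have length at least \<open>r\<close>, so inserting a vertex at the cut or
  removing it changes neither independence nor the property of having diameter at least \<open>s\<close>.
  The image consists of all large faces because these avoid the cut.
\<close>
lemma long_faces_Suc:
  assumes n: "2 * r + m \<le> n"
  shows "long_faces (Suc n) = image skip ` long_faces n"
proof (intro equalityI subsetI)
  have cn: "cut \<le> n" using n u_less u_plus_v by (simp add: cut_def)
  {
    fix H assume "H \<in> image skip ` long_faces n"
    then obtain F where F: "F \<in> long_faces n" and H: "H = skip ` F" by auto
    have gap: "x + r \<le> y" if "x \<in> F" "y \<in> F" "x < cut" "cut \<le> y" for x y
      using long_face_gap[OF n F] that by simp
    obtain x y where xy: "x \<in> F" "y \<in> F" "x + s \<le> y" using F by (auto simp: long_faces_def)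
    then have "skip x + s \<le> skip y" by (auto simp: skip_def)
    moreover have "H \<subseteq> {1..Suc n}"
      using F s_less_r unfolding H by (auto simp: long_faces_def face_iff skip_def cut_def)
    moreover have "(skip x, skip y) \<notin> stretch r E (Suc n)" if "x \<in> F" "y \<in> F" for x y
      using skip_edge[OF n, of x y] gap[OF that] that F by (auto simp: long_faces_def face_iff)
    ultimately show "H \<in> long_faces (Suc n)"
      using xy unfolding long_faces_def face_iff mem_Collect_eq H by blast
  next
    fix H assume H: "H \<in> long_faces (Suc n)"
    have n': "2 * r + m \<le> Suc n" using n by simp
    have "cut \<notin> H" by (rule cut_notin_long_face[OF n' H])
    then have "z \<in> range skip" if "z \<in> H" for z
    proof (cases "z < cut")
      case True
      then show ?thesis by (auto simp: skip_def intro!: range_eqI[of _ _ z])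
    next
      case False
      with \<open>cut \<notin> H\<close> that have "cut < z" by (metis linorder_neqE_nat)
      then show ?thesis by (intro range_eqI[of _ _ "z - 1"]) (auto simp: skip_def)
    qed
    then obtain F where F: "H = skip ` F" by (metis subset_imageE subsetI)
    have "F \<subseteq> {1..n}"
    proof
      fix x assume "x \<in> F"
      then have "skip x \<in> {1..Suc n}" using H F by (auto simp: long_faces_def face_iff)
      then show "x \<in> {1..n}" using cn s_less_r by (auto simp: skip_def cut_def split: if_splits)
    qed
    moreover have "(x, y) \<notin> stretch r E n" if "x \<in> F" "y \<in> F" for x y
      using edge_skip[of x y n] H F that by (auto simp: long_faces_def face_iff)
    moreover obtain x y where xy: "x \<in> F" "y \<in> F" "skip x + s \<le> skip y"
      using H F by (auto simp: long_faces_def)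
    moreover have "x + s \<le> y"
      using xy long_face_gap[OF n' H, of "skip x" "skip y"] F s_less_r
      by (auto simp: skip_def split: if_splits)
    ultimately have "F \<in> long_faces n"
      unfolding long_faces_def face_iff mem_Collect_eq by blast
    with F show "H \<in> image skip ` long_faces n" by auto
  }
qed

lemma card_long_faces_Suc:
  assumes "2 * r + m \<le> n"
  shows "card {F \<in> long_faces (Suc n). card F = k} = card {F \<in> long_faces n. card F = k}"
proof -
  have "{F \<in> long_faces (Suc n). card F = k} = image skip ` {F \<in> long_faces n. card F = k}"
    using inj_skip by (auto simp: long_faces_Suc[OF assms] card_image inj_on_subset)
  then show ?thesis
    by (simp add: card_image inj_on_image[OF inj_on_subset[OF inj_skip]])
qed

lemma short_sets_Suc:
  assumes "s \<le> Suc n"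
  shows "short_sets (Suc n) = short_sets n \<union> insert (Suc n) ` Pow {n + 2 - s..n}"
proof (intro equalityI subsetI)
  fix F assume F: "F \<in> short_sets (Suc n)"
  show "F \<in> short_sets n \<union> insert (Suc n) ` Pow {n + 2 - s..n}"
  proof (cases "Suc n \<in> F")
    case True
    have "x \<in> {n + 2 - s..n}" if "x \<in> F - {Suc n}" for x
    proof -
      have "x \<le> Suc n" "Suc n < x + s" using F that True by (auto simp: short_sets_def)
      with that show ?thesis by auto
    qed
    then have "F - {Suc n} \<in> Pow {n + 2 - s..n}" by blast
    moreover have "F = insert (Suc n) (F - {Suc n})" using True by blast
    ultimately show ?thesis by blast
  next
    case False
    then show ?thesis using F by (force simp: short_sets_def le_Suc_eq)
  qed
next
  fix F assume "F \<in> short_sets n \<union> insert (Suc n) ` Pow {n + 2 - s..n}"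
  then show "F \<in> short_sets (Suc n)"
  proof
    assume "F \<in> short_sets n"
    then show ?thesis by (force simp: short_sets_def)
  next
    assume "F \<in> insert (Suc n) ` Pow {n + 2 - s..n}"
    then have sub: "F \<subseteq> {n + 2 - s..Suc n}" using s_pos by auto
    have "y < x + s" if "x \<in> F" "y \<in> F" for x y
      using sub[THEN subsetD, OF that(1)] sub[THEN subsetD, OF that(2)] s_pos by auto
    moreover have "F \<subseteq> {1..Suc n}" using sub assms by force
    ultimately show ?thesis unfolding short_sets_def by blast
  qed
qed

lemma card_short_sets_Suc:
  assumes "s \<le> Suc n"
  shows "card {F \<in> short_sets (Suc n). card F = Suc i} =
    card {F \<in> short_sets n. card F = Suc i} + (s - 1 choose i)"
proof -
  let ?T = "{T. T \<subseteq> {n + 2 - s..n} \<and> card T = i}"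
  have "{F \<in> short_sets (Suc n). card F = Suc i} =
      {F \<in> short_sets n. card F = Suc i} \<union> insert (Suc n) ` ?T"
  proof -
    have "card (insert (Suc n) T) = Suc (card T)" if "T \<subseteq> {n + 2 - s..n}" for T
      using that by (subst card_insert_disjoint) (auto intro: finite_subset)
    then show ?thesis by (auto simp: short_sets_Suc[OF assms])
  qed
  moreover have "finite (short_sets n)"
    by (rule finite_subset[of _ "Pow {1..n}"]) (auto simp: short_sets_def)
  moreover have "finite ?T" by (rule finite_subset[of _ "Pow {n + 2 - s..n}"]) auto
  moreover have "short_sets n \<inter> insert (Suc n) ` ?T = {}" by (auto simp: short_sets_def)
  ultimately have "card {F \<in> short_sets (Suc n). card F = Suc i} =
      card {F \<in> short_sets n. card F = Suc i} + card (insert (Suc n) ` ?T)"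
    by (simp add: card_Un_disjoint disjoint_iff)
  also have "card (insert (Suc n) ` ?T) = card ?T"
  proof (rule card_image, rule inj_onI)
    fix T T' assume "T \<in> ?T" "T' \<in> ?T" "insert (Suc n) T = insert (Suc n) T'"
    moreover have "Suc n \<notin> T" "Suc n \<notin> T'" using calculation by auto
    ultimately show "T = T'" by (metis insert_ident)
  qed
  also have "card ?T = (s - 1 choose i)"
    using n_subsets[of "{n + 2 - s..n}" i] assms s_pos by simp
  finally show ?thesis .
qed

lemma finite_faces: "finite (IN (stretched r E n))"
  by (rule finite_subset[of _ "Pow {1..n}"]) (use face_iff in blast)+

theorem f_vec_Suc:
  assumes "2 * r + m \<le> n"
  shows "f_vec (IN (stretched r E (Suc n))) (int i) =
    f_vec (IN (stretched r E n)) (int i) + (s - 1 choose i)"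
proof -
  have split: "f_vec (IN (stretched r E k)) (int i) =
      card {F \<in> long_faces k. card F = Suc i} + card {F \<in> short_sets k. card F = Suc i}" for k
  proof -
    have "{F \<in> IN (stretched r E k). int (card F) = int i + 1} =
        {F \<in> long_faces k. card F = Suc i} \<union> {F \<in> short_sets k. card F = Suc i}"
      by (auto simp: faces_split(1))
    moreover have "finite (long_faces k)" "finite (short_sets k)"
      using finite_faces[of k] by (simp_all add: faces_split(1))
    ultimately show ?thesis
      using faces_split(2)[of k] unfolding f_vec_def
      by (simp add: card_Un_disjoint disjoint_iff)
  qed
  show ?thesis
    using card_long_faces_Suc[OF assms] card_short_sets_Suc[of n i] assms s_less_r
    by (simp add: split)
qed

end

section \<open>From the \<open>f\<close>-vector to the \<open>h\<close>-vector and the Euler characteristic\<close>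

text \<open>
  The coefficient of \<open>x ^ j\<close> in \<open>(1 - x) ^ (d - s) = (\<Sum>i. (s choose i) * x ^ i * (1 - x) ^ (d - i))\<close>,
  an expansion of \<open>(1 - x) ^ (d - s) * (x + (1 - x)) ^ s\<close>.  The induction on \<open>s\<close> uses Pascal's rule
  on both sides.
\<close>
lemma alternating_binomial_convolution:
  assumes "s \<le> d"
  shows "(\<Sum>i\<le>j. (-1) ^ (j - i) * int (d - i choose (j - i)) * int (s choose i)) =
    (-1) ^ j * int (d - s choose j)"
  using assms
proof (induction s arbitrary: d j)
  case 0
  have "(\<Sum>i\<le>j. (-1) ^ (j - i) * int (d - i choose (j - i)) * int (0 choose i)) =
      (\<Sum>i\<in>{0}. (-1) ^ (j - i) * int (d - i choose (j - i)) * int (0 choose i))"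
    by (rule sum.mono_neutral_right) auto
  then show ?case by simp
next
  case (Suc s)
  let ?t = "\<lambda>d s j i. (-1) ^ (j - i) * int (d - i choose (j - i)) * int (s choose i)"
  obtain d' where d: "d = Suc d'" "s \<le> d'" using Suc.prems by (cases d) auto
  show ?case
  proof (cases j)
    case (Suc j')
    have "(\<Sum>i\<le>j. ?t d (Suc s) j i) = ?t d (Suc s) j 0 + (\<Sum>i\<le>j'. ?t d (Suc s) j (Suc i))"
      unfolding Suc by (rule sum.atMost_Suc_shift)
    also have "(\<Sum>i\<le>j'. ?t d (Suc s) j (Suc i)) = (\<Sum>i\<le>j'. ?t d s j (Suc i)) + (\<Sum>i\<le>j'. ?t d' s j' i)"
      unfolding sum.distrib[symmetric] by (simp add: Suc d algebra_simps)
    also have "?t d (Suc s) j 0 + (\<dots>) = (\<Sum>i\<le>j. ?t d s j i) + (\<Sum>i\<le>j'. ?t d' s j' i)"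
      unfolding Suc sum.atMost_Suc_shift[of "?t d s (Suc j')"] by simp
    also have "\<dots> = (-1) ^ j * int (d - s choose j) + (-1) ^ j' * int (d' - s choose j')"
      using Suc.IH[of d j] Suc.IH[of d' j'] d Suc.prems by simp
    also have "\<dots> = (-1) ^ j * int (d - Suc s choose j)"
      using d by (simp add: Suc Suc_diff_le algebra_simps)
    finally show ?thesis .
  qed simp
qed

text \<open>
  Two complexes whose \<open>f\<close>-vectors differ by the face numbers that \<open>s - 1\<close> vertices in a full simplex
  contribute when a new vertex is joined to them.  The condition on the maximum ensures that the
  new faces do not raise the dimension.
\<close>
locale f_vector_step =
  fixes \<Delta> \<Delta>' :: "nat set set" and s :: nat
  assumes finite: "finite \<Delta>" "finite \<Delta>'"
    and finite_face: "F \<in> \<Delta> \<union> \<Delta>' \<Longrightarrow> finite F"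
    and empty: "{} \<in> \<Delta>" "{} \<in> \<Delta>'"
    and step: "f_vec \<Delta>' (int i) = f_vec \<Delta> (int i) + (s - 1 choose i)"
    and s: "1 \<le> s" "s \<le> Max (card ` \<Delta>)"
begin

lemma Max_card_eq: "Max (card ` \<Delta>') = Max (card ` \<Delta>)"
proof -
  have pos: "Suc k \<in> card ` D \<longleftrightarrow> 0 < f_vec D (int k)" if "finite D" for k and D :: "nat set set"
    using that by (auto simp: f_vec_def card_gt_0_iff image_iff intro: bexI[rotated])
  have "k \<in> card ` \<Delta>'" if "k \<in> card ` \<Delta>" for k
    using that empty by (cases k) (auto simp: pos finite step simp del: image_iff intro: image_eqI[of _ _ "{}"])
  moreover have "k \<in> card ` \<Delta> \<or> k \<le> s" if "k \<in> card ` \<Delta>'" for k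
    using that s(1) by (cases k) (auto simp: pos finite step binomial_eq_0_iff simp del: image_iff)
  ultimately have sub: "card ` \<Delta> \<subseteq> card ` \<Delta>'" "card ` \<Delta>' \<subseteq> card ` \<Delta> \<union> {..s}" by auto
  have "k \<le> Max (card ` \<Delta>)" if "k \<in> card ` \<Delta>'" for k
    using subsetD[OF sub(2) that] Max_ge[of "card ` \<Delta>" k] finite(1) s by auto
  then have "Max (card ` \<Delta>') \<le> Max (card ` \<Delta>)"
    using finite(2) empty by (intro Max.boundedI) auto
  moreover have "Max (card ` \<Delta>) \<le> Max (card ` \<Delta>')"
    using sub(1) finite(2) empty by (intro Max_mono) auto
  ultimately show ?thesis by simp
qed

text \<open>
  The entry \<open>f\<^bsub>-1\<^esub> = 1\<close> is the same for both complexes, so the summand \<open>i = 0\<close> cancels and the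
  difference is the alternating convolution with all indices lowered by one.
\<close>
lemma h_vec_step:
  assumes d: "d = Max (card ` \<Delta>)"
  shows "h_vec \<Delta>' j = h_vec \<Delta> j + (-1) ^ (j - 1) * binom (int d - int s) (int j - 1)"
proof -
  have d': "Max (card ` \<Delta>') = d" using Max_card_eq d by simp
  have f0: "f_vec D (-1) = 1" if "finite D" "{} \<in> D" "\<forall>F\<in>D. finite F" for D :: "nat set set"
  proof -
    have "{F \<in> D. int (card F) = -1 + 1} = {{}}" using that by auto
    then show ?thesis by (simp add: f_vec_def)
  qed
  show ?thesis
  proof (cases "j \<le> d")
    case False
    then show ?thesis using d d' s by (simp add: h_vec_def dimension_def binom_def Let_def)
  next
    case True
    let ?t = "\<lambda>D i. (-1) ^ (j - i) * int ((d - i) choose (j - i)) * int (f_vec D (int i - 1))"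
    have h: "h_vec \<Delta>' j = (\<Sum>i\<le>j. ?t \<Delta>' i)" "h_vec \<Delta> j = (\<Sum>i\<le>j. ?t \<Delta> i)"
      using True d d' by (simp_all add: h_vec_def dimension_def Let_def atLeast0AtMost)
    show ?thesis
    proof (cases j)
      case 0
      have "f_vec \<Delta>' (-1) = f_vec \<Delta> (-1)"
        using f0[of \<Delta>] f0[of \<Delta>'] finite empty finite_face by auto
      then show ?thesis using h by (simp add: 0 binom_def)
    next
      case (Suc k)
      have "h_vec \<Delta>' j - h_vec \<Delta> j = (\<Sum>i\<le>k. ?t \<Delta>' (Suc i) - ?t \<Delta> (Suc i))"
        using f0[of \<Delta>] f0[of \<Delta>'] finite empty finite_face
        unfolding h unfolding Suc sum.atMost_Suc_shift by (simp add: sum_subtractf)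
      also have "\<dots> = (\<Sum>i\<le>k. (-1) ^ (k - i) * int (d - 1 - i choose (k - i)) * int (s - 1 choose i))"
        by (rule sum.cong) (simp_all add: Suc step algebra_simps)
      also have "\<dots> = (-1) ^ k * int (d - 1 - (s - 1) choose k)"
        using s d by (intro alternating_binomial_convolution) simp
      also have "int (d - 1 - (s - 1) choose k) = binom (int d - int s) (int j - 1)"
        using s d by (auto simp: binom_def Suc binomial_eq_0_iff nat_diff_distrib)
      finally show ?thesis by (simp add: Suc)
    qed
  qed
qed

text \<open>The increment is the alternating sum of the row \<open>s - 1\<close> of Pascal's triangle.\<close>
lemma euler_char_step: "euler_char \<Delta>' = euler_char \<Delta> + (if s = 1 then 1 else 0)"
proof -
  let ?d = "Max (card ` \<Delta>)"
  have e: "euler_char D = (\<Sum>i<Max (card ` D). (-1) ^ i * int (f_vec D (int i)))" for D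
    unfolding euler_char_def dimension_def by (rule sum.cong) auto
  have "euler_char \<Delta>' - euler_char \<Delta> = (\<Sum>i<?d. (-1) ^ i * int (s - 1 choose i))"
    by (simp add: e Max_card_eq step sum_subtractf[symmetric] algebra_simps)
  also have "\<dots> = (\<Sum>i\<le>s - 1. (-1) ^ i * int (s - 1 choose i))"
    using s by (intro sum.mono_neutral_right) auto
  also have "\<dots> = (if s = 1 then 1 else 0)"
    using s choose_alternating_sum[of "s - 1", where 'a = int] by auto
  finally show ?thesis by simp
qed

end

lemma eventually_linearI:
  fixes g :: "nat \<Rightarrow> int"
  assumes "\<And>n. N \<le> n \<Longrightarrow> g (Suc n) = g n + k"
  shows "eventually_linear g"
proof -
  have "g n = k * int n + (g N - k * int N)" if "N \<le> n" for n
    using that by (induction n rule: dec_induct) (auto simp: assms algebra_simps)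
  then show ?thesis
    unfolding eventually_linear_def eventually_sequentially by blast
qed

section \<open>The graphs of a chain\<close>

lemma sparsity_index:
  assumes "finite (edges (G (ind G)))" "edges (G (ind G)) \<noteq> {}"
    and increasing: "\<And>i j. (i, j) \<in> edges (G (ind G)) \<Longrightarrow> i < j"
  shows "\<exists>i. (i, i + sp G) \<in> edges (G (ind G))"
    and "(i, j) \<in> edges (G (ind G)) \<Longrightarrow> i + sp G \<le> j"
proof -
  let ?E = "edges (G (ind G))"
  have sp: "sp G = Min ((\<lambda>(i, j). j - i) ` ?E)"
    unfolding sp_def by (rule arg_cong[of _ _ Min]) force
  have "sp G \<in> (\<lambda>(i, j). j - i) ` ?E"
    unfolding sp using assms(1,2) by (intro Min_in) auto
  then obtain a b where "(a, b) \<in> ?E" "sp G = b - a" by auto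
  with increasing[of a b] have "(a, a + sp G) \<in> ?E" by simp
  then show "\<exists>i. (i, i + sp G) \<in> ?E" ..
  show "i + sp G \<le> j" if "(i, j) \<in> ?E"
  proof -
    have "sp G \<le> j - i"
      unfolding sp using assms(1) that by (intro Min_le) (auto intro: image_eqI[of _ _ "(i, j)"])
    with increasing[OF that] show ?thesis by simp
  qed
qed

lemma indep_number_eq_Max_card: "indep_number H = Max (card ` IN H)"
  unfolding indep_number_def IN_def by (rule arg_cong[of _ _ Max]) auto

theorem theorem4p1:
  fixes G :: "nat \<Rightarrow> graph" and r s m :: nat
  assumes "Inc_chain G"
    and "ind G = r"
    and "sp G = s"
    and "me G = m"
    and "verts (G r) = {1..r}"
    and "\<exists>i\<in>{1..r}. \<exists>j\<in>{1..r}. (1, i) \<in> edges (G r) \<and> (j, r) \<in> edges (G r)"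
  shows
    "(\<forall>n\<ge>2 * r + m.
        indep_number (G (n + 1)) = indep_number (G n)) \<and>
     (\<forall>n\<ge>2 * r + m. \<forall>i::nat.
        int (f_vec (IN (G (n + 1))) (int i)) =
          int (f_vec (IN (G n)) (int i)) + binom (int s - 1) (int i)) \<and>
     (\<forall>i::nat. eventually_linear (\<lambda>n. int (f_vec (IN (G n)) (int i)))) \<and>
     (\<forall>n\<ge>2 * r + m. \<forall>d. d = indep_number (G n) \<longrightarrow> (\<forall>i::nat.
        h_vec (IN (G (n + 1))) i =
          h_vec (IN (G n)) i + (-1) ^ (i - 1) * binom (int d - int s) (int i - 1))) \<and>
     (\<forall>i::nat. eventually_linear (\<lambda>n. h_vec (IN (G n)) i)) \<and>
     (\<forall>n\<ge>2 * r + m. \<forall>\<E>\<in>{euler_char, reduced_euler_char}.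
        (s = 1 \<longrightarrow> \<E> (IN (G (n + 1))) = \<E> (IN (G n)) + 1) \<and>
        (s \<ge> 2 \<longrightarrow> \<E> (IN (G (n + 1))) = \<E> (IN (G n))))"
proof -
  define E where "E = edges (G r)"
  have r: "1 \<le> r" using stable_at_ind(1)[OF assms(1)] assms(2) by simp
  have graph: "is_graph (G r)" using assms(1) r by (simp add: Inc_chain_def)
  have E_bounds: "1 \<le> i \<and> i < j \<and> j \<le> r" if "(i, j) \<in> E" for i j
    using graph that assms(5) by (auto simp: is_graph_def E_def)
  have "finite E"
    by (rule finite_subset[of _ "{1..r} \<times> {1..r}"]) (use E_bounds in fastforce)+
  moreover have "E \<noteq> {}" using assms(6) by (auto simp: E_def)
  ultimately have shortest: "\<exists>i. (i, i + s) \<in> E" and length_ge: "\<And>i j. (i, j) \<in> E \<Longrightarrow> i + s \<le> j"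
    using sparsity_index[of G] E_bounds assms(2,3) by (auto simp: E_def)
  have m: "m = (r choose 2) - card E"
    using assms(2,4,5) by (simp add: me_def E_def)
  interpret seed_graph r s m E
    using E_bounds assms(6) shortest length_ge m by unfold_locales (auto simp: E_def)
  have G: "G n = stretched r E n" if "r \<le> n" for n
    using chain_eq_stretched[OF assms(1), of n] assms(2,5) that by (simp add: E_def)

  have step: "f_vector_step (IN (G n)) (IN (G (Suc n))) s" if n: "2 * r + m \<le> n" for n
  proof -
    have Gn: "G n = stretched r E n" "G (Suc n) = stretched r E (Suc n)" using n by (auto intro: G)
    have "{1..s} \<in> IN (G n)"
      unfolding Gn faces_split using n s_less_r by (auto simp: short_sets_def)
    then have "card {1..s} \<le> Max (card ` IN (G n))"
      using finite_faces[of n] by (intro Max_ge imageI finite_imageI) (simp_all add: Gn)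
    moreover have "finite F" if "F \<in> IN (G n) \<union> IN (G (Suc n))" for F
      using that finite_subset[of F "{1..Suc n}"] by (force simp: Gn face_iff)
    ultimately show ?thesis
      using f_vec_Suc[OF n] s_pos finite_faces
      by unfold_locales (auto simp: Gn face_iff)
  qed

  have alpha: "indep_number (G (n + 1)) = indep_number (G n)" if "2 * r + m \<le> n" for n
    using f_vector_step.Max_card_eq[OF step[OF that]] by (simp add: indep_number_eq_Max_card)
  have f: "int (f_vec (IN (G (n + 1))) (int i)) =
      int (f_vec (IN (G n)) (int i)) + binom (int s - 1) (int i)" if "2 * r + m \<le> n" for n i
  proof -
    have "int (s - 1 choose i) = binom (int s - 1) (int i)"
      using s_pos by (auto simp: binom_def nat_diff_distrib binomial_eq_0_iff)
    then show ?thesis using f_vector_step.step[OF step[OF that], of i] by simp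
  qed
  have h: "h_vec (IN (G (n + 1))) i = h_vec (IN (G n)) i +
      (-1) ^ (i - 1) * binom (int (indep_number (G n)) - int s) (int i - 1)"
    if "2 * r + m \<le> n" for n i
    using f_vector_step.h_vec_step[OF step[OF that] refl] by (simp add: indep_number_eq_Max_card)
  have e: "euler_char (IN (G (n + 1))) = euler_char (IN (G n)) + (if s = 1 then 1 else 0)"
    if "2 * r + m \<le> n" for n
    using f_vector_step.euler_char_step[OF step[OF that]] by simp

  have alpha_const: "indep_number (G n) = indep_number (G (2 * r + m))" if "2 * r + m \<le> n" for n
    using that
  proof (induction n rule: dec_induct)
    case (step n)
    then show ?case using alpha[OF step(1)] by simp
  qed simp
  have linear_f: "eventually_linear (\<lambda>n. int (f_vec (IN (G n)) (int i)))" for i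
    by (rule eventually_linearI[of "2 * r + m"], unfold Suc_eq_plus1) (rule f)
  have linear_h: "eventually_linear (\<lambda>n. h_vec (IN (G n)) i)" for i
  proof (rule eventually_linearI[of "2 * r + m"])
    fix n assume n: "2 * r + m \<le> n"
    show "h_vec (IN (G (Suc n))) i = h_vec (IN (G n)) i +
        (-1) ^ (i - 1) * binom (int (indep_number (G (2 * r + m))) - int s) (int i - 1)"
      using h[OF n, of i] unfolding alpha_const[OF n] Suc_eq_plus1 .
  qed
  have "(s = 1 \<longrightarrow> \<E> (IN (G (n + 1))) = \<E> (IN (G n)) + 1) \<and>
      (s \<ge> 2 \<longrightarrow> \<E> (IN (G (n + 1))) = \<E> (IN (G n)))"
    if "2 * r + m \<le> n" "\<E> \<in> {euler_char, reduced_euler_char}" for n \<E>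
    using that(2) e[OF that(1)] by (auto simp: reduced_euler_char_def)
  then show ?thesis
    using alpha f h linear_f linear_h by blast
qed

end
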